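(* Let $G$ be a finite simple graph that is $\{2K_2, K_2+P_4\}$-free and satisfies $\omega(G)\geq 4$. Then $\chi(G)\leq \omega(G)+2$.
   Context: $\chi(G)$ is the chromatic number and $\omega(G)$ the clique number of $G$. $2K_2$ is the disjoint union of two edges; $P_4$ is the path on four vertices. For graphs $G_1,G_2$, the join $G_1+G_2$ is their disjoint union together with all edges between $V(G_1)$ and $V(G_2)$; so $K_2+P_4$ is the graph on six vertices consisting of an edge and a $P_4$ with every vertex of the edge adjacent to every vertex of the $P_4$. A graph is $\mathcal{F}$-free if it has no induced subgraph isomorphic to a member of $\mathcal{F}$. *)

theory Defs
  imports "Graph_Theory.Graph_Theory"
begin

text \<open>
  An undirected simple graph is, as usual in this library, a symmetric loop-free digraph without
  parallel arcs: an edge \<open>uv\<close> is represented by the two arcs \<open>(u, v)\<close> and \<open>(v, u)\<close>. Finiteness of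
  the vertex set is part of the locale predicate \<^const>\<open>graph\<close>.
\<close>

definition proper_coloring :: "('a, 'b) pre_digraph \<Rightarrow> nat \<Rightarrow> ('a \<Rightarrow> nat) \<Rightarrow> bool" where
  "proper_coloring G k c \<longleftrightarrow>
     (\<forall>v \<in> verts G. c v < k) \<and>
     (\<forall>u \<in> verts G. \<forall>v \<in> verts G. u \<rightarrow>\<^bsub>G\<^esub> v \<longrightarrow> c u \<noteq> c v)"

definition chromatic_number :: "('a, 'b) pre_digraph \<Rightarrow> nat" where
  "chromatic_number G = (LEAST k. \<exists>c. proper_coloring G k c)"

definition clique_number :: "('a, 'b) pre_digraph \<Rightarrow> nat" where
  "clique_number G = Max {n. \<exists>H. subgraph H G \<and> K\<^bsub>n\<^esub> H}"

definition induced_free ::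
    "('c, 'd) pre_digraph set \<Rightarrow> ('a, 'b) pre_digraph \<Rightarrow> bool" where
  "induced_free \<F> G \<longleftrightarrow> \<not> (\<exists>F \<in> \<F>. \<exists>H. induced_subgraph H G \<and> digraph_iso H F)"

definition complete_graph :: "nat \<Rightarrow> nat pair_pre_digraph" where
  "complete_graph n =
     \<lparr> pverts = {..<n}, parcs = {(u, v). u < n \<and> v < n \<and> u \<noteq> v} \<rparr>"

definition path_graph :: "nat \<Rightarrow> nat pair_pre_digraph" where
  "path_graph n =
     \<lparr> pverts = {..<n}, parcs = {(u, v). u < n \<and> v < n \<and> (v = Suc u \<or> u = Suc v)} \<rparr>"

definition disjoint_union ::
    "'a pair_pre_digraph \<Rightarrow> 'b pair_pre_digraph \<Rightarrow> ('a + 'b) pair_pre_digraph" where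
  "disjoint_union G H =
     \<lparr> pverts = pverts G <+> pverts H,
       parcs = map_prod Inl Inl ` parcs G \<union> map_prod Inr Inr ` parcs H \<rparr>"

definition graph_join ::
    "'a pair_pre_digraph \<Rightarrow> 'b pair_pre_digraph \<Rightarrow> ('a + 'b) pair_pre_digraph" where
  "graph_join G H =
     \<lparr> pverts = pverts (disjoint_union G H),
       parcs = parcs (disjoint_union G H) \<union>
         (Inl ` pverts G) \<times> (Inr ` pverts H) \<union> (Inr ` pverts H) \<times> (Inl ` pverts G) \<rparr>"

definition two_K2 :: "(nat + nat) pair_pre_digraph" where
  "two_K2 = disjoint_union (complete_graph 2) (complete_graph 2)"

definition K2_join_P4 :: "(nat + nat) pair_pre_digraph" where
  "K2_join_P4 = graph_join (complete_graph 2) (path_graph 4)"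

end

theory Submission
  imports Defs
begin

text \<open>
  Fix a maximum clique \<open>f 0, \<dots>, f (w - 1)\<close> and let \<open>M x\<close> be the set of indices of clique vertices not
  adjacent to \<open>x\<close>. If \<open>x\<close> and \<open>y\<close> are adjacent, then \<open>M x\<close> and \<open>M y\<close> share at most one index, because
  two common indices would give a \<open>2K\<^sub>2\<close>; and if two indices lie outside \<open>M x \<union> M y\<close>, then \<open>M x\<close> and
  \<open>M y\<close> are disjoint, because a common index would give a larger clique or a \<open>P\<^sub>4\<close> joined to an edge.
  So the vertices with \<open>{0, 1} \<subseteq> M x\<close> form one colour class and those with \<open>{2, 3} \<subseteq> M x\<close> a second
  one. The trace of \<open>M x\<close> on \<open>{0, 1, 2, 3}\<close> for any other \<open>x\<close> is empty, a singleton or one of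
  \<open>02, 13, 12, 03\<close>; grouping the traces as \<open>0, 02 | 1, 13 | 2, 12 | 3, 03\<close>, any two members of a
  group share an index and jointly avoid two others, so each group is a colour class. Vertices with
  empty trace are coloured by any element of \<open>M x\<close>.
\<close>

section \<open>Induced copies of the two forbidden graphs\<close>

lemma (in nomulti_digraph) induced_copyI:
  fixes F :: "'c pair_pre_digraph" and g :: "'c \<Rightarrow> 'a"
  assumes inj: "inj_on g (pverts F)"
    and sub: "g ` pverts F \<subseteq> verts G"
    and wf: "parcs F \<subseteq> pverts F \<times> pverts F"
    and adj: "\<And>u v. \<lbrakk>u \<in> pverts F; v \<in> pverts F\<rbrakk> \<Longrightarrow> (u, v) \<in> parcs F \<longleftrightarrow> g u \<rightarrow>\<^bsub>G\<^esub> g v"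
  shows "\<exists>H. induced_subgraph H G \<and> digraph_iso H (with_proj F)"
proof -
  define H where "H = G \<restriction> (g ` pverts F)"
  define h where "h = the_inv_into (pverts F) g"
  have hg: "h (g u) = u" if "u \<in> pverts F" for u
    using that inj by (simp add: h_def the_inv_into_f_f)
  \<comment> \<open>The isomorphism runs from \<open>H\<close> to the pattern, so it uses the
    inverse \<open>h\<close> on vertices and sends each arc to the pair of images of its
    ends.\<close>
  define hom :: "('a, 'b, 'c, 'c \<times> 'c) digraph_isomorphism" where
    "hom = \<lparr>iso_verts = h, iso_arcs = (\<lambda>a. (h (tail G a), h (head G a))),
            iso_head = snd, iso_tail = fst\<rparr>"
  have ind: "induced_subgraph H G"
    unfolding H_def using sub by (rule induced_induce)
  then have wfH: "wf_digraph H"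
    by (auto simp: induced_subgraph_def subgraph_def)
  have "inj_on h (g ` pverts F)"
    using hg by (auto intro!: inj_onI)
  moreover have "inj_on (\<lambda>a. (h (tail G a), h (head G a))) (arcs H)"
  proof (rule inj_onI)
    fix a b
    assume a: "a \<in> arcs H" and b: "b \<in> arcs H"
      and eq: "(h (tail G a), h (head G a)) = (h (tail G b), h (head G b))"
    then have "tail G a = tail G b" "head G a = head G b"
      using hg by (auto simp: H_def)
    \<comment> \<open>Arcs with the same ends coincide because \<open>G\<close> has no parallel
      arcs.\<close>
    then show "a = b"
      using a b by (intro no_multi_arcs) (auto simp: H_def arc_to_ends_def)
  qed
  ultimately have iso: "pre_digraph.digraph_isomorphism H hom"
    using wfH by (simp add: pre_digraph.digraph_isomorphism_def hom_def H_def)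
  have "h ` g ` pverts F = pverts F"
    using hg by (auto simp: image_image)
  moreover have "(\<lambda>a. (h (tail G a), h (head G a))) ` arcs H = parcs F"
  proof (intro equalityI subsetI)
    fix p assume "p \<in> (\<lambda>a. (h (tail G a), h (head G a))) ` arcs H"
    then obtain a u v where "a \<in> arcs G" "tail G a = g u" "head G a = g v"
      "u \<in> pverts F" "v \<in> pverts F" "p = (h (tail G a), h (head G a))"
      by (auto simp: H_def)
    then show "p \<in> parcs F"
      using adj[of u v] hg by (auto simp: arcs_ends_conv intro: rev_image_eqI)
  next
    fix p assume p: "p \<in> parcs F"
    obtain u v where uv: "p = (u, v)" by (cases p)
    then have mem: "u \<in> pverts F" "v \<in> pverts F"
      using p wf by auto
    then have "g u \<rightarrow>\<^bsub>G\<^esub> g v" using adj p uv by auto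
    then obtain a where "a \<in> arcs G" "tail G a = g u" "head G a = g v" by blast
    then show "p \<in> (\<lambda>a. (h (tail G a), h (head G a))) ` arcs H"
      using uv mem hg by (intro rev_image_eqI[of a]) (auto simp: H_def)
  qed
  ultimately have "with_proj F = app_iso hom H"
    by (intro pre_digraph.equality) (auto simp: hom_def H_def)
  with iso ind show ?thesis
    by (auto simp: digraph_iso_def)
qed

context graph
begin

lemma adj_sym: "u \<rightarrow> v \<Longrightarrow> v \<rightarrow> u"
  using arcs_ends_symmetric[OF sym_arcs] .

text \<open>Distinctness of the four vertices is derived: identifying ends of the two edges would
  turn one of the edges into a forbidden adjacency.\<close>

lemma two_K2_free:
  assumes free: "induced_free {with_proj two_K2, with_proj K2_join_P4} G"
    and V: "{a, b, c, d} \<subseteq> verts G"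
    and ab: "a \<rightarrow> b" and cd: "c \<rightarrow> d"
    and non: "\<not> a \<rightarrow> c" "\<not> a \<rightarrow> d" "\<not> b \<rightarrow> c" "\<not> b \<rightarrow> d"
  shows False
proof -
  have [simp]: "{..<2::nat} = {0, 1}" by auto
  have loop: "\<not> x \<rightarrow> x" for x by (meson adj_not_same)
  have dist: "a \<noteq> b" "c \<noteq> d" "a \<noteq> c" "a \<noteq> d" "b \<noteq> c" "b \<noteq> d"
    using ab cd non loop adj_sym by blast+
  have sym: "b \<rightarrow> a" "d \<rightarrow> c" "\<not> c \<rightarrow> a" "\<not> d \<rightarrow> a" "\<not> c \<rightarrow> b" "\<not> d \<rightarrow> b"
    using ab cd non adj_sym by blast+
  define g where
    "g = case_sum (\<lambda>n::nat. if n = 0 then a else b) (\<lambda>n::nat. if n = 0 then c else d)"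
  have verts: "pverts two_K2 = {Inl 0, Inl 1, Inr 0, Inr 1}"
    by (auto simp: two_K2_def disjoint_union_def complete_graph_def)
  have arcs: "parcs two_K2 = {(Inl 0, Inl 1), (Inl 1, Inl 0), (Inr 0, Inr 1), (Inr 1, Inr 0)}"
  proof -
    have "parcs (complete_graph 2) = {(0, 1), (1, 0)}"
      by (auto simp: complete_graph_def)
    then show ?thesis
      by (auto simp: two_K2_def disjoint_union_def)
  qed
  have "\<exists>H. induced_subgraph H G \<and> digraph_iso H (with_proj two_K2)"
  proof (rule induced_copyI[of g])
    show "inj_on g (pverts two_K2)"
      using dist by (auto simp: verts g_def inj_on_def)
    show "g ` pverts two_K2 \<subseteq> verts G"
      using V by (auto simp: verts g_def)
    show "parcs two_K2 \<subseteq> pverts two_K2 \<times> pverts two_K2"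
      by (auto simp: verts arcs)
    show "(u, v) \<in> parcs two_K2 \<longleftrightarrow> g u \<rightarrow> g v"
      if "u \<in> pverts two_K2" "v \<in> pverts two_K2" for u v
      using that ab cd non sym loop by (auto simp: verts arcs g_def)
  qed
  with free show False by (auto simp: induced_free_def)
qed

text \<open>The vertices are distinct here too, by looplessness and the three non-adjacencies on the
  path \<open>a\<close>, \<open>b\<close>, \<open>c\<close>, \<open>d\<close>; the edge
  \<open>p\<close>, \<open>q\<close> is the \<open>K2\<close> side.\<close>

lemma K2_join_P4_free:
  assumes free: "induced_free {with_proj two_K2, with_proj K2_join_P4} G"
    and V: "{p, q, a, b, c, d} \<subseteq> verts G"
    and pq: "p \<rightarrow> q"
    and path: "a \<rightarrow> b" "b \<rightarrow> c" "c \<rightarrow> d" "\<not> a \<rightarrow> c" "\<not> a \<rightarrow> d" "\<not> b \<rightarrow> d"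
    and join: "p \<rightarrow> a" "p \<rightarrow> b" "p \<rightarrow> c" "p \<rightarrow> d" "q \<rightarrow> a" "q \<rightarrow> b" "q \<rightarrow> c" "q \<rightarrow> d"
  shows False
proof -
  have [simp]: "{..<2::nat} = {0, 1}" "{..<4::nat} = {0, 1, 2, 3}" by auto
  have loop: "\<not> x \<rightarrow> x" for x by (meson adj_not_same)
  have dist: "p \<noteq> q" "a \<noteq> b" "b \<noteq> c" "c \<noteq> d" "a \<noteq> c" "a \<noteq> d" "b \<noteq> d"
    "p \<noteq> a" "p \<noteq> b" "p \<noteq> c" "p \<noteq> d" "q \<noteq> a" "q \<noteq> b" "q \<noteq> c" "q \<noteq> d"
    using pq path join loop adj_sym by blast+
  note sym = pq[THEN adj_sym] path(1-3)[THEN adj_sym] join[THEN adj_sym]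
  have nsym: "\<not> c \<rightarrow> a" "\<not> d \<rightarrow> a" "\<not> d \<rightarrow> b"
    using path adj_sym by blast+
  define g where
    "g = case_sum (\<lambda>n::nat. if n = 0 then p else q)
      (\<lambda>n::nat. if n = 0 then a else if n = 1 then b else if n = 2 then c else d)"
  have verts: "pverts K2_join_P4 = {Inl 0, Inl 1, Inr 0, Inr 1, Inr 2, Inr 3}"
    by (auto simp: K2_join_P4_def graph_join_def disjoint_union_def complete_graph_def
        path_graph_def)
  have arcs: "parcs K2_join_P4 =
    map_prod Inl Inl ` {(0, 1), (1, 0)} \<union>
    map_prod Inr Inr ` {(0, 1), (1, 0), (1, 2), (2, 1), (2, 3), (3, 2)} \<union>
    {Inl 0, Inl 1} \<times> {Inr 0, Inr 1, Inr 2, Inr 3} \<union> {Inr 0, Inr 1, Inr 2, Inr 3} \<times> {Inl 0, Inl 1}"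
  proof -
    have "parcs (complete_graph 2) = {(0, 1), (1, 0)}"
      by (auto simp: complete_graph_def)
    moreover have "parcs (path_graph 4) = {(0, 1), (1, 0), (1, 2), (2, 1), (2, 3), (3, 2)}"
      by (auto simp: path_graph_def)
    moreover have "pverts (complete_graph 2) = {0, 1}" "pverts (path_graph 4) = {0, 1, 2, 3}"
      by (auto simp: complete_graph_def path_graph_def)
    ultimately show ?thesis
      by (simp add: K2_join_P4_def graph_join_def disjoint_union_def)
  qed
  have "\<exists>H. induced_subgraph H G \<and> digraph_iso H (with_proj K2_join_P4)"
  proof (rule induced_copyI[of g])
    show "inj_on g (pverts K2_join_P4)"
      by (simp add: verts g_def inj_on_def dist dist[symmetric])
    show "g ` pverts K2_join_P4 \<subseteq> verts G"
      using V by (auto simp: verts g_def)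
    show "parcs K2_join_P4 \<subseteq> pverts K2_join_P4 \<times> pverts K2_join_P4"
      by (auto simp: verts arcs)
    show "(u, v) \<in> parcs K2_join_P4 \<longleftrightarrow> g u \<rightarrow> g v"
      if "u \<in> pverts K2_join_P4" "v \<in> pverts K2_join_P4" for u v
      using that unfolding verts
      \<comment> \<open>The 36 ordered pairs of pattern vertices are checked one by one.\<close>
      by (elim insertE emptyE; simp add: arcs g_def pq path join sym nsym loop)
  qed
  with free show False by (auto simp: induced_free_def)
qed

section \<open>Cliques as vertex sets\<close>

definition clique :: "'a set \<Rightarrow> bool" where
  "clique S \<longleftrightarrow> S \<subseteq> verts G \<and> (\<forall>u \<in> S. \<forall>v \<in> S. u \<noteq> v \<longrightarrow> u \<rightarrow> v)"

text \<open>Arcs of a subgraph are arcs of \<open>G\<close>, so a complete subgraph has a clique as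
  its vertex set; conversely the subgraph induced by a clique is complete because \<open>G\<close>
  has no loops.\<close>

lemma ex_complete_subgraph_iff:
  "(\<exists>H. subgraph H G \<and> K\<^bsub>n\<^esub> H) \<longleftrightarrow> (\<exists>S. clique S \<and> card S = n)"
proof
  assume "\<exists>H. subgraph H G \<and> K\<^bsub>n\<^esub> H"
  then obtain H where H: "subgraph H G" "K\<^bsub>n\<^esub> H" by blast
  have "u \<rightarrow> v" if "u \<in> verts H" "v \<in> verts H" "u \<noteq> v" for u v
  proof -
    have "u \<rightarrow>\<^bsub>H\<^esub> v" using H(2) that by (auto simp: complete_digraph_def)
    then show ?thesis
      using H(1) by (auto simp: arcs_ends_conv subgraph_def compatible_def)
  qed
  then have "clique (verts H)"
    using H(1) by (auto simp: clique_def subgraph_def)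
  then show "\<exists>S. clique S \<and> card S = n"
    using H(2) by (auto simp: complete_digraph_def)
next
  assume "\<exists>S. clique S \<and> card S = n"
  then obtain S where S: "clique S" "card S = n" by blast
  then have sub: "S \<subseteq> verts G" by (simp add: clique_def)
  define H where "H = G \<restriction> S"
  have ind: "induced_subgraph H G"
    unfolding H_def using sub by (rule induced_induce)
  then have "graph H"
    by (intro digraph.graphI digraphI_induced induced_graph_imp_symmetric[OF sym_arcs])
  moreover have "arcs_ends H = {(u, v). (u, v) \<in> verts H \<times> verts H \<and> u \<noteq> v}"
  proof (intro equalityI subsetI)
    fix e assume "e \<in> arcs_ends H"
    then show "e \<in> {(u, v). (u, v) \<in> verts H \<times> verts H \<and> u \<noteq> v}"
      using no_loops by (auto simp: arcs_ends_conv H_def)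
  next
    fix e assume "e \<in> {(u, v). (u, v) \<in> verts H \<times> verts H \<and> u \<noteq> v}"
    then obtain u v where uv: "e = (u, v)" "u \<in> S" "v \<in> S" "u \<noteq> v"
      by (auto simp: H_def)
    then have "u \<rightarrow> v" using S(1) by (auto simp: clique_def)
    then show "e \<in> arcs_ends H"
      using uv by (auto simp: arcs_ends_conv H_def)
  qed
  ultimately have "K\<^bsub>n\<^esub> H"
    using S(2) by (simp add: complete_digraph_def H_def)
  with ind show "\<exists>H. subgraph H G \<and> K\<^bsub>n\<^esub> H"
    by (auto dest: induced_imp_subgraph)
qed

lemma clique_number_attained:
  obtains S where "clique S" "card S = clique_number G"
    and "\<And>T. clique T \<Longrightarrow> card T \<le> clique_number G"
proof -
  define N where "N = {n. \<exists>S. clique S \<and> card S = n}"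
  have num: "clique_number G = Max N"
    by (simp add: clique_number_def ex_complete_subgraph_iff N_def)
  have "N \<subseteq> {..card (verts G)}"
    by (auto simp: N_def clique_def intro: card_mono)
  then have fin: "finite N" by (rule finite_subset) simp
  \<comment> \<open>The empty clique makes \<open>N\<close> nonempty, so its maximum is
    attained.\<close>
  have "clique {}" by (simp add: clique_def)
  then have "N \<noteq> {}" by (auto simp: N_def)
  with fin have "Max N \<in> N" by (rule Max_in)
  moreover have "card T \<le> Max N" if "clique T" for T
    using that fin by (auto simp: N_def intro: Max_ge)
  ultimately show thesis
    using that num by (auto simp: N_def)
qed

end

section \<open>Non-neighbours in a maximum clique\<close>

locale forbidden_with_max_clique = graph G for G :: "('a, 'b) pre_digraph" (structure) +
  fixes f :: "nat \<Rightarrow> 'a" and w :: nat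
  assumes free: "induced_free {with_proj two_K2, with_proj K2_join_P4} G"
    and inj_f: "inj_on f {..<w}"
    and clique_f: "clique (f ` {..<w})"
    and max_clique: "\<And>T. clique T \<Longrightarrow> card T \<le> w"
begin

text \<open>Looplessness gives \<open>M (f i) = {i}\<close> for \<open>i < w\<close>, so clique
  vertices need no separate treatment.\<close>

definition M :: "'a \<Rightarrow> nat set" where
  "M x = {i. i < w \<and> \<not> x \<rightarrow> f i}"

lemma f_in_verts: "i < w \<Longrightarrow> f i \<in> verts G"
  using clique_f by (auto simp: clique_def)

lemma f_adj: "\<lbrakk>i < w; j < w; i \<noteq> j\<rbrakk> \<Longrightarrow> f i \<rightarrow> f j"
  using clique_f inj_onD[OF inj_f, of i j] by (auto simp: clique_def)

text \<open>Otherwise \<open>x\<close> could be added to the maximum clique.\<close>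

lemma M_nonempty:
  assumes "x \<in> verts G"
  shows "M x \<noteq> {}"
proof
  assume "M x = {}"
  then have adj: "x \<rightarrow> f i" if "i < w" for i using that by (auto simp: M_def)
  have "x \<notin> f ` {..<w}" using adj adj_not_same by auto
  then have "card (insert x (f ` {..<w})) = Suc w"
    by (simp add: card_image inj_f)
  moreover have "clique (insert x (f ` {..<w}))"
    using clique_f assms adj adj_sym by (auto simp: clique_def)
  ultimately show False using max_clique by fastforce
qed

lemma adj_imp_not_both_in_M:
  assumes "x \<in> verts G" "y \<in> verts G" "x \<rightarrow> y" "i \<noteq> j" "{i, j} \<subseteq> M x" "{i, j} \<subseteq> M y"
  shows False
  using assms f_in_verts f_adj[of i j]
  by (intro two_K2_free[OF free, of x y "f i" "f j"]) (auto simp: M_def)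

text \<open>The vertices \<open>x\<close>, \<open>y\<close>, \<open>f j\<close>, \<open>f i\<close>
  form an induced path in this order, and \<open>f p\<close>, \<open>f q\<close> are adjacent to
  each other and to the whole path.\<close>

lemma P4_with_common_edge:
  assumes V: "x \<in> verts G" "y \<in> verts G" and xy: "x \<rightarrow> y"
    and pq: "p < w" "q < w" "p \<noteq> q" "p \<notin> M x \<union> M y" "q \<notin> M x \<union> M y"
    and i: "i \<in> M x" "i \<in> M y" and j: "j \<in> M x" "j \<noteq> i"
  shows False
proof -
  have ij: "i < w" "j < w" using i j by (auto simp: M_def)
  \<comment> \<open>Sharing both \<open>i\<close> and \<open>j\<close> would give two disjoint edges
    with no arcs between them.\<close>
  have "j \<notin> M y" using adj_imp_not_both_in_M[of x y i j] V xy i j by auto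
  then have yj: "y \<rightarrow> f j" using ij by (auto simp: M_def)
  have ne: "p \<noteq> i" "p \<noteq> j" "q \<noteq> i" "q \<noteq> j" using pq i j by auto
  have "x \<rightarrow> f p" "x \<rightarrow> f q" "y \<rightarrow> f p" "y \<rightarrow> f q" using pq by (auto simp: M_def)
  note adj = this[THEN adj_sym]
  show False
    by (rule K2_join_P4_free[OF free, of "f p" "f q" x y "f j" "f i"])
      (use V xy yj adj pq ne ij i j f_in_verts f_adj in \<open>auto simp: M_def\<close>)
qed

text \<open>A common index \<open>i\<close> would be the only element of both sets, since a further
  one yields the forbidden join. Replacing \<open>f i\<close> by \<open>x\<close> and
  \<open>y\<close> then enlarges the maximum clique.\<close>

lemma adj_imp_M_disjoint:
  assumes V: "x \<in> verts G" "y \<in> verts G" and xy: "x \<rightarrow> y"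
    and pq: "p < w" "q < w" "p \<noteq> q" "p \<notin> M x \<union> M y" "q \<notin> M x \<union> M y"
  shows "M x \<inter> M y = {}"
proof (rule ccontr)
  assume "M x \<inter> M y \<noteq> {}"
  then obtain i where i: "i \<in> M x" "i \<in> M y" by blast
  have Mx: "M x = {i}"
    using P4_with_common_edge[OF V xy pq i] i by blast
  have My: "M y = {i}"
    \<comment> \<open>The same argument with \<open>x\<close> and \<open>y\<close>
      exchanged.\<close>
    using P4_with_common_edge[OF V(2,1) adj_sym[OF xy] pq(1-3) _ _ i(2,1)] pq i by blast
  have iw: "i < w" using i by (auto simp: M_def)
  define B where "B = f ` ({..<w} - {i})"
  have x_adj: "x \<rightarrow> b" "b \<rightarrow> x" and y_adj: "y \<rightarrow> b" "b \<rightarrow> y" if "b \<in> B" for b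
    using that Mx My adj_sym by (auto simp: B_def M_def)
  have B_sub: "B \<subseteq> verts G"
    using clique_f by (auto simp: clique_def B_def)
  have B_adj: "b \<rightarrow> c" if "b \<in> B" "c \<in> B" "b \<noteq> c" for b c
    using clique_f that by (auto simp: clique_def B_def)
  have notin: "x \<notin> B" "y \<notin> B" "x \<noteq> y"
    using x_adj y_adj xy adj_not_same by blast+
  have "card B = w - 1"
    using iw inj_f by (simp add: B_def card_image inj_on_diff)
  then have "card (insert x (insert y B)) = Suc w"
    using notin iw by (simp add: B_def)
  moreover have "clique (insert x (insert y B))"
    unfolding clique_def
    using V xy adj_sym[OF xy] x_adj y_adj B_sub B_adj by auto
  ultimately show False using max_clique by fastforce
qed

section \<open>The colouring with two extra colours\<close>

text \<open>Once the first two tests fail, the next four pick out the traces \<open>0, 02\<close>,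
  then \<open>1, 13\<close>, then \<open>2, 12\<close>, then \<open>3, 03\<close>. The last branch
  is reached only when the trace on \<open>{0, 1, 2, 3}\<close> is empty.\<close>

definition colour :: "'a \<Rightarrow> nat" where
  "colour x =
    (if {0, 1} \<subseteq> M x then w
     else if {2, 3} \<subseteq> M x then w + 1
     else if 0 \<in> M x \<and> 3 \<notin> M x then 0
     else if 1 \<in> M x \<and> 2 \<notin> M x then 1
     else if 2 \<in> M x \<and> 0 \<notin> M x then 2
     else if 3 \<in> M x \<and> 1 \<notin> M x then 3
     else (LEAST i. i \<in> M x))"

text \<open>Each case records what excludes edges inside its class: two common indices for the extra
  colours, and otherwise the colour itself as a common index along with two missing indices.\<close>

lemma colour_cases:
  assumes "x \<in> verts G"
  obtains "colour x = w" "{0, 1} \<subseteq> M x"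
  | "colour x = w + 1" "{2, 3} \<subseteq> M x"
  | "colour x < w" "colour x \<in> M x" "colour x = 0" "1 \<notin> M x" "3 \<notin> M x"
  | "colour x < w" "colour x \<in> M x" "colour x = 1" "0 \<notin> M x" "2 \<notin> M x"
  | "colour x < w" "colour x \<in> M x" "colour x = 2" "0 \<notin> M x" "3 \<notin> M x"
  | "colour x < w" "colour x \<in> M x" "colour x = 3" "1 \<notin> M x" "2 \<notin> M x"
  | "colour x < w" "colour x \<in> M x" "colour x > 3" "0 \<notin> M x" "1 \<notin> M x"
proof -
  define l where "l = (LEAST i. i \<in> M x)"
  have l: "l \<in> M x"
    unfolding l_def using M_nonempty[OF assms] by (meson LeastI ex_in_conv)
  then have lw: "l < w" by (simp add: M_def)
  have M_less: "i < w" if "i \<in> M x" for i using that by (simp add: M_def)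
  \<comment> \<open>This keeps vertices with empty trace out of the classes \<open>0\<close> to
    \<open>3\<close>.\<close>
  have l_gt: "l > 3" if "0 \<notin> M x" "1 \<notin> M x" "2 \<notin> M x" "3 \<notin> M x"
  proof (rule ccontr)
    assume "\<not> l > 3"
    then have "l = 0 \<or> l = 1 \<or> l = 2 \<or> l = 3" by auto
    then show False using l that by auto
  qed
  consider "{0, 1} \<subseteq> M x"
    | "\<not> {0, 1} \<subseteq> M x" "{2, 3} \<subseteq> M x"
    | "0 \<in> M x" "1 \<notin> M x" "3 \<notin> M x"
    | "1 \<in> M x" "0 \<notin> M x" "2 \<notin> M x"
    | "2 \<in> M x" "0 \<notin> M x" "3 \<notin> M x"
    | "3 \<in> M x" "1 \<notin> M x" "2 \<notin> M x"
    | "0 \<notin> M x" "1 \<notin> M x" "2 \<notin> M x" "3 \<notin> M x"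
    by blast
  then show thesis
  proof cases
    case 1
    then show thesis using that(1) by (simp add: colour_def)
  next
    case 2
    then have "colour x = w + 1" unfolding colour_def by (simp only: if_True if_False)
    then show thesis using that(2) 2 by blast
  next
    case 3
    then have "colour x = 0" by (simp add: colour_def)
    then show thesis using that(3) 3 M_less by auto
  next
    case 4
    then have "colour x = 1" by (simp add: colour_def)
    then show thesis using that(4) 4 M_less by auto
  next
    case 5
    then have "colour x = 2" by (simp add: colour_def)
    then show thesis using that(5) 5 M_less by auto
  next
    case 6
    then have "colour x = 3" by (simp add: colour_def)
    then show thesis using that(6) 6 M_less by auto
  next
    case 7
    then have "colour x = l" by (simp add: colour_def l_def)
    then show thesis using that(7) 7 l lw l_gt by auto
  qed
qed

lemma proper_colour:
  assumes "w \<ge> 4"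
  shows "proper_coloring G (w + 2) colour"
  unfolding proper_coloring_def
proof (intro conjI ballI impI)
  fix v assume "v \<in> verts G"
  then show "colour v < w + 2" by (cases v rule: colour_cases) auto
next
  fix u v assume V: "u \<in> verts G" "v \<in> verts G" and uv: "u \<rightarrow> v"
  show "colour u \<noteq> colour v"
  proof
    assume eq: "colour u = colour v"
    note disj = adj_imp_M_disjoint[OF V uv]
    show False
      using V(1)
    proof (cases u rule: colour_cases)
      case 1
      from V(2) have "{0, 1} \<subseteq> M v" using 1(1) eq by (cases v rule: colour_cases) auto
      then show False using adj_imp_not_both_in_M[OF V uv, of 0 1] 1 by auto
    next
      case 2
      from V(2) have "{2, 3} \<subseteq> M v" using 2(1) eq by (cases v rule: colour_cases) auto
      then show False using adj_imp_not_both_in_M[OF V uv, of 2 3] 2 by auto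
    next
      case 3
      \<comment> \<open>Equal colours force \<open>v\<close> into the same case as \<open>u\<close>,
        so the common colour lies in both \<open>M u\<close> and \<open>M v\<close> while
        \<open>1\<close> and \<open>3\<close> lie in neither; \<open>w \<ge> 4\<close> makes both of
        them valid indices. The remaining cases are analogous.\<close>
      from V(2) have "1 \<notin> M v \<and> 3 \<notin> M v \<and> colour v \<in> M v"
        using 3(1-3) eq by (cases v rule: colour_cases) auto
      then show False using disj[of 1 3] assms 3 eq by auto
    next
      case 4
      from V(2) have "0 \<notin> M v \<and> 2 \<notin> M v \<and> colour v \<in> M v"
        using 4(1-3) eq by (cases v rule: colour_cases) auto
      then show False using disj[of 0 2] assms 4 eq by auto
    next
      case 5
      from V(2) have "0 \<notin> M v \<and> 3 \<notin> M v \<and> colour v \<in> M v"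
        using 5(1-3) eq by (cases v rule: colour_cases) auto
      then show False using disj[of 0 3] assms 5 eq by auto
    next
      case 6
      from V(2) have "1 \<notin> M v \<and> 2 \<notin> M v \<and> colour v \<in> M v"
        using 6(1-3) eq by (cases v rule: colour_cases) auto
      then show False using disj[of 1 2] assms 6 eq by auto
    next
      case 7
      from V(2) have "0 \<notin> M v \<and> 1 \<notin> M v \<and> colour v \<in> M v"
        using 7(1-3) eq by (cases v rule: colour_cases) auto
      then show False using disj[of 0 1] assms 7 eq by auto
    qed
  qed
qed

end

theorem theorem2p6:
  fixes G :: "('a, 'b) pre_digraph"
  assumes "graph G"
    and "induced_free {with_proj two_K2, with_proj K2_join_P4} G"
    and "clique_number G \<ge> 4"
  shows "chromatic_number G \<le> clique_number G + 2"
proof -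
  interpret graph G by fact
  let ?w = "clique_number G"
  obtain S where S: "clique S" "card S = ?w" and max: "\<And>T. clique T \<Longrightarrow> card T \<le> ?w"
    using clique_number_attained by blast
  have "finite S" using S(1) finite_verts by (auto simp: clique_def intro: finite_subset)
  then obtain f where "bij_betw f {..<?w} S"
    using ex_bij_betw_nat_finite[of S] S(2) by (auto simp: atLeast0LessThan)
  then have "inj_on f {..<?w}" "clique (f ` {..<?w})"
    using S(1) by (auto simp: bij_betw_def)
  then interpret forbidden_with_max_clique G f ?w
    using assms(2) max by unfold_locales auto
  have "proper_coloring G (?w + 2) colour"
    using assms(3) by (rule proper_colour)
  then show ?thesis
    unfolding chromatic_number_def by (intro Least_le) blast
qed

end
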